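(* Let $(A_1,\ldots,A_d)$ be a positive definite SDC family of real symmetric $n\times n$ matrices with $\|A_1\|_2=\cdots=\|A_d\|_2=1$, let $E_1,\ldots,E_d\in\mathbb{R}^{n\times n}$ be symmetric, and let $\tilde A_k=A_k+\epsilon E_k$. Let $\theta=[1/d,\ldots,1/d]$ and $\mu\in\mathbb{R}^d$. For sufficiently small $\epsilon>0$ (so that $\tilde A(\theta)$ is positive definite), let $\tilde A(\theta)=\tilde L\tilde L^T$ be the Cholesky factorization with $\tilde L$ lower triangular, let $\tilde Q$ be an orthogonal matrix such that $\tilde Q^T\tilde L^{-1}\tilde A(\mu)\tilde L^{-T}\tilde Q$ is diagonal, and set $\tilde X=\tilde L^{-T}\tilde Q$. Then, for $\epsilon$ sufficiently small, $$\kappa(\tilde X)\le d\sqrt{\kappa^*}+\mathcal{O}(\epsilon),$$ where $\kappa^*:=\min_{\nu\in\Delta^d}\kappa(A(\nu))$ and $\Delta^d:=\{\nu\in\mathbb{R}^d:\ \nu_1+\cdots+\nu_d=1,\ \nu_k\ge 0\}$.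
   Context: All matrices are real. For $\mu\in\mathbb{R}^d$, $A(\mu):=\mu_1A_1+\cdots+\mu_dA_d$ and $\tilde A(\mu):=\mu_1\tilde A_1+\cdots+\mu_d\tilde A_d$. A family of symmetric matrices is SDC if there is an invertible $X\in\mathbb{R}^{n\times n}$ such that every $X^TA_kX$ is diagonal. A family of symmetric matrices is positive definite if $A(\mu)$ is positive definite for every $\mu\in\mathbb{R}^d$ with all entries positive. $\|\cdot\|_2$ is the spectral norm, and $\kappa(M)=\|M\|_2\|M^{-1}\|_2$ is the condition number ($\kappa(M)=\infty$ if $M$ is singular). The term $\mathcal{O}(\epsilon)$ is understood as $\epsilon\to0$ with the matrices $A_k,E_k$ fixed. *)

theory Defs
  imports "HOL-Analysis.Analysis" "HOL-Library.Landau_Symbols"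
begin

definition symmetric_matrix :: "real^'n^'n \<Rightarrow> bool" where
  "symmetric_matrix M \<longleftrightarrow> transpose M = M"

definition diagonal_matrix :: "real^'n^'n \<Rightarrow> bool" where
  "diagonal_matrix M \<longleftrightarrow> (\<forall>i j. i \<noteq> j \<longrightarrow> M $ i $ j = 0)"

definition lower_triangular :: "real^'n::{finite,linorder}^'n::{finite,linorder} \<Rightarrow> bool" where
  "lower_triangular M \<longleftrightarrow> (\<forall>i j. i < j \<longrightarrow> M $ i $ j = 0)"

definition positive_definite :: "real^'n^'n \<Rightarrow> bool" where
  "positive_definite M \<longleftrightarrow> symmetric_matrix M \<and> (\<forall>x. x \<noteq> 0 \<longrightarrow> x \<bullet> (M *v x) > 0)"

definition lincomb :: "('d::finite \<Rightarrow> real^'n^'n) \<Rightarrow> real^'d \<Rightarrow> real^'n^'n" where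
  "lincomb A \<mu> = (\<Sum>k\<in>UNIV. (\<mu> $ k) *\<^sub>R A k)"

definition perturbed ::
    "('d::finite \<Rightarrow> real^'n^'n) \<Rightarrow> ('d \<Rightarrow> real^'n^'n) \<Rightarrow> real \<Rightarrow> 'd \<Rightarrow> real^'n^'n" where
  "perturbed A E \<epsilon> = (\<lambda>k. A k + \<epsilon> *\<^sub>R E k)"

definition SDC :: "('d::finite \<Rightarrow> real^'n^'n) \<Rightarrow> bool" where
  "SDC A \<longleftrightarrow> (\<forall>k. symmetric_matrix (A k)) \<and>
     (\<exists>X :: real^'n^'n. invertible X \<and> (\<forall>k. diagonal_matrix (transpose X ** A k ** X)))"

definition positive_definite_family :: "('d::finite \<Rightarrow> real^'n^'n) \<Rightarrow> bool" where
  "positive_definite_family A \<longleftrightarrow> (\<forall>k. symmetric_matrix (A k)) \<and>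
     (\<forall>\<mu>. (\<forall>k. \<mu> $ k > 0) \<longrightarrow> positive_definite (lincomb A \<mu>))"

text \<open>The norm of type class \<^class>\<open>real_normed_vector\<close> on real^'n^'n is the
  Frobenius norm, so the spectral norm is taken as the operator norm for the Euclidean norm.\<close>

definition spectral_norm :: "real^'n^'n \<Rightarrow> real" where
  "spectral_norm M = onorm (\<lambda>x. M *v x)"

definition cond_number :: "real^'n^'n \<Rightarrow> ereal" where
  "cond_number M =
     (if invertible M then ereal (spectral_norm M * spectral_norm (matrix_inv M)) else \<infinity>)"

definition prob_simplex :: "(real^'d::finite) set" where
  "prob_simplex = {\<nu>. (\<Sum>k\<in>UNIV. \<nu> $ k) = 1 \<and> (\<forall>k. \<nu> $ k \<ge> 0)}"

text \<open>\<^const>\<open>Least\<close> rather than \<^const>\<open>Inf\<close>: its value is determined only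
  if the minimum over the simplex is attained. For a positive definite family the minimum
  is finite, since the matrix at the barycenter is invertible.\<close>

definition min_cond :: "('d::finite \<Rightarrow> real^'n^'n) \<Rightarrow> ereal" where
  "min_cond A = (LEAST c. \<exists>\<nu>\<in>prob_simplex. c = cond_number (lincomb A \<nu>))"

definition barycenter :: "real^'d::finite" where
  "barycenter = (\<chi> k. 1 / real CARD('d))"

end

theory Submission
  imports Defs
begin

text \<open>
  Write \<open>d\<close> for the number of matrices and \<open>\<theta>\<close> for the barycenter of the simplex. The singular values
  of \<open>X = L\<^sup>-\<^sup>T Q\<close> depend only on the factored matrix \<open>M = L L\<^sup>T\<close>: they are the square roots of the
  eigenvalues of \<open>M\<^sup>-\<^sup>1\<close>, so \<open>\<kappa>(X) = \<surd>\<kappa>(M)\<close> (lemma \<open>cond_number_cholesky\<close>). It remains to bound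
  the condition number of the perturbed matrix at \<open>\<theta>\<close>.

  Near an invertible positive semidefinite matrix the condition number is Lipschitz
  (\<open>spectral_cond_lipschitz\<close>), which reduces the question, up to a term linear in \<open>\<epsilon>\<close>, to the
  unperturbed matrix \<open>A(\<theta>)\<close>.  The square root preserves the linear error because \<open>\<kappa> \<ge> 1\<close>.

  For \<open>A(\<theta>)\<close> the point is that every \<open>A k\<close> is positive semidefinite, as a limit of positive definite
  combinations. Hence for each \<open>\<nu>\<close> in the simplex \<open>d A(\<theta>) = \<Sum>A k\<close> dominates \<open>A(\<nu>) = \<Sum>\<nu> k A k\<close> in the
  Loewner order, and if \<open>A(\<nu>)\<close> is invertible then \<open>\<parallel>A(\<theta>)\<^sup>-\<^sup>1\<parallel> \<le> d \<parallel>A(\<nu>)\<^sup>-\<^sup>1\<parallel>\<close>. Moreover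
  \<open>\<parallel>A(\<theta>)\<parallel> \<le> 1\<close> and \<open>\<parallel>A(\<nu>)\<parallel> \<ge> 1/d\<close> by the normalization, so that \<open>\<kappa>(A(\<theta>)) \<le> d\<^sup>2 \<kappa>(A(\<nu>))\<close>
  (\<open>simplex_cond_barycenter\<close>). Taking \<open>\<nu>\<close> to be a minimizer, which exists by \<open>min_cond_attained\<close>, and
  then square roots gives the factor \<open>d \<surd>\<kappa>\<^sup>*\<close>.

  Inequalities between norms of positive semidefinite matrices and their quadratic forms are derived
  from the Cauchy--Schwarz inequality for the form, without diagonalizing the matrix.
\<close>

section \<open>The spectral norm\<close>

lemma norm_mult_le_spectral_norm: "norm (M *v x) \<le> spectral_norm M * norm x"
  unfolding spectral_norm_def by (rule onorm) simp

lemma spectral_norm_nonneg: "0 \<le> spectral_norm M"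
  unfolding spectral_norm_def by (rule onorm_pos_le) simp

lemma spectral_norm_leI: "(\<And>x. norm (M *v x) \<le> b * norm x) \<Longrightarrow> spectral_norm M \<le> b"
  unfolding spectral_norm_def by (rule onorm_le)

lemma spectral_norm_mat_1: "spectral_norm (mat 1 :: real^'n^'n) = 1"
  unfolding spectral_norm_def matrix_vector_mul_lid by (rule onorm_id)

lemma spectral_norm_add: "spectral_norm (M + N) \<le> spectral_norm M + spectral_norm N"
  unfolding spectral_norm_def matrix_vector_mult_add_rdistrib
  by (rule onorm_triangle) simp_all

lemma spectral_norm_scaleR: "spectral_norm (r *\<^sub>R M) = \<bar>r\<bar> * spectral_norm M"
  unfolding spectral_norm_def scaleR_matrix_vector_assoc[symmetric]
  by (rule onorm_scaleR) simp

lemma spectral_norm_minus_commute: "spectral_norm (M - N) = spectral_norm (N - M)"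
  using spectral_norm_scaleR[of "-1" "M - N"] by simp

lemma spectral_norm_diff: "\<bar>spectral_norm M - spectral_norm N\<bar> \<le> spectral_norm (M - N)"
  using spectral_norm_add[of "M - N" N] spectral_norm_add[of "N - M" M]
  by (simp add: spectral_norm_minus_commute[of N M])

lemma spectral_norm_mult: "spectral_norm (M ** N) \<le> spectral_norm M * spectral_norm N"
proof (rule spectral_norm_leI)
  fix x
  have "norm ((M ** N) *v x) \<le> spectral_norm M * norm (N *v x)"
    unfolding matrix_vector_mul_assoc[symmetric] by (rule norm_mult_le_spectral_norm)
  also have "\<dots> \<le> spectral_norm M * (spectral_norm N * norm x)"
    by (intro mult_left_mono norm_mult_le_spectral_norm spectral_norm_nonneg)
  finally show "norm ((M ** N) *v x) \<le> spectral_norm M * spectral_norm N * norm x"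
    by (simp add: mult.assoc)
qed

lemma inner_matrix_transpose: "x \<bullet> (M *v y) = (transpose M *v x) \<bullet> (y :: real^'n)"
  for M :: "real^'n^'n"
  by (simp add: dot_lmul_matrix)

lemma quadratic_form_le_spectral_norm: "\<bar>x \<bullet> (M *v x)\<bar> \<le> spectral_norm M * (x \<bullet> x)"
proof -
  have "\<bar>x \<bullet> (M *v x)\<bar> \<le> norm x * norm (M *v x)" by (rule Cauchy_Schwarz_ineq2)
  also have "\<dots> \<le> norm x * (spectral_norm M * norm x)"
    by (intro mult_left_mono norm_mult_le_spectral_norm) simp
  finally show ?thesis by (simp add: power2_norm_eq_inner[symmetric] power2_eq_square ac_simps)
qed

text \<open>The quadratic form of \<open>M\<^sup>T M\<close> at \<open>x\<close> is \<open>\<parallel>M x\<parallel>\<^sup>2\<close>.\<close>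

lemma spectral_norm_sq_le_gram: "(spectral_norm M)\<^sup>2 \<le> spectral_norm (transpose M ** M)"
proof -
  have "spectral_norm M \<le> sqrt (spectral_norm (transpose M ** M))"
  proof (rule spectral_norm_leI)
    fix x
    have "(norm (M *v x))\<^sup>2 = x \<bullet> ((transpose M ** M) *v x)"
      by (simp only: power2_norm_eq_inner matrix_vector_mul_assoc[symmetric]
          inner_matrix_transpose[of x "transpose M" "M *v x"] transpose_transpose)
    also have "\<dots> \<le> spectral_norm (transpose M ** M) * (x \<bullet> x)"
      using quadratic_form_le_spectral_norm[of x "transpose M ** M"] by linarith
    finally have "(norm (M *v x))\<^sup>2 \<le> spectral_norm (transpose M ** M) * (x \<bullet> x)" .
    then have "norm (M *v x) \<le> sqrt (spectral_norm (transpose M ** M) * (x \<bullet> x))"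
      by (rule real_le_rsqrt)
    then show "norm (M *v x) \<le> sqrt (spectral_norm (transpose M ** M)) * norm x"
      by (simp add: real_sqrt_mult norm_eq_sqrt_inner)
  qed
  then show ?thesis
    using spectral_norm_nonneg by (metis power_mono real_sqrt_pow2)
qed

text \<open>The case \<open>M x \<noteq> 0\<close> of \<open>\<parallel>M x\<parallel>\<^sup>2 = x \<bullet> M\<^sup>T M x \<le> \<parallel>x\<parallel> \<parallel>M\<^sup>T\<parallel> \<parallel>M x\<parallel>\<close>, divided by \<open>\<parallel>M x\<parallel>\<close>.\<close>

lemma spectral_norm_le_transpose: "spectral_norm M \<le> spectral_norm (transpose M)"
proof (rule spectral_norm_leI)
  fix x
  have "norm (M *v x) * norm (M *v x) = x \<bullet> (transpose M *v (M *v x))"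
    by (simp only: inner_matrix_transpose[of x "transpose M" "M *v x"] transpose_transpose
        power2_norm_eq_inner[symmetric] power2_eq_square)
  also have "\<dots> \<le> norm x * norm (transpose M *v (M *v x))"
    using Cauchy_Schwarz_ineq2 abs_le_D1 by blast
  also have "\<dots> \<le> norm x * (spectral_norm (transpose M) * norm (M *v x))"
    by (intro mult_left_mono norm_mult_le_spectral_norm) simp
  finally have "norm (M *v x) * norm (M *v x)
      \<le> (spectral_norm (transpose M) * norm x) * norm (M *v x)"
    by (simp only: ac_simps)
  then show "norm (M *v x) \<le> spectral_norm (transpose M) * norm x"
    using spectral_norm_nonneg[of "transpose M"]
    by (cases "norm (M *v x) = 0") (auto simp: mult_le_cancel_right)
qed

section \<open>Lower bounds in the Loewner order\<close>

text \<open>For symmetric \<open>M\<close> this says that \<open>M - c I\<close> is positive semidefinite, that is, that no eigenvalue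
  of \<open>M\<close> is below \<open>c\<close>. The case \<open>c = 0\<close> expresses that \<open>M\<close> is positive semidefinite.\<close>

definition coercive :: "real \<Rightarrow> real^'n^'n \<Rightarrow> bool" where
  "coercive c M \<longleftrightarrow> (\<forall>x. c * (x \<bullet> x) \<le> x \<bullet> (M *v x))"

text \<open>As for inner products, the form is evaluated at \<open>c x - b y\<close> with \<open>b = x \<bullet> M y\<close> and
  \<open>c = y \<bullet> M y\<close>. Only semidefiniteness is assumed, so the case \<open>c = 0\<close> needs its own argument.\<close>

lemma psd_Cauchy_Schwarz:
  fixes M :: "real^'n^'n"
  assumes "symmetric_matrix M" "coercive 0 M"
  shows "(x \<bullet> (M *v y))\<^sup>2 \<le> (x \<bullet> (M *v x)) * (y \<bullet> (M *v y))"
proof -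
  define a b c where "a = x \<bullet> (M *v x)" and "b = x \<bullet> (M *v y)" and "c = y \<bullet> (M *v y)"
  have b': "y \<bullet> (M *v x) = b"
    using assms(1) inner_matrix_transpose[of y M x]
    by (simp add: symmetric_matrix_def b_def inner_commute)
  have nonneg: "0 \<le> a" "0 \<le> c"
    using assms(2) by (auto simp: a_def c_def coercive_def)
  have form: "0 \<le> r\<^sup>2 * a + 2 * r * t * b + t\<^sup>2 * c" for r t
  proof -
    have "0 \<le> (r *\<^sub>R x + t *\<^sub>R y) \<bullet> (M *v (r *\<^sub>R x + t *\<^sub>R y))"
      using assms(2) by (simp add: coercive_def)
    also have "\<dots> = r\<^sup>2 * a + 2 * r * t * b + t\<^sup>2 * c"
      by (simp add: matrix_vector_right_distrib matrix_vector_mult_scaleR inner_add_left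
          inner_add_right b' a_def[symmetric] b_def[symmetric] c_def[symmetric]
          power2_eq_square algebra_simps)
    finally show ?thesis .
  qed
  have "b\<^sup>2 \<le> a * c"
  proof (cases "c = 0")
    case False
    have "0 \<le> c * (a * c - b\<^sup>2)"
      using form[of c "-b"] by (simp add: power2_eq_square algebra_simps)
    then show ?thesis using False nonneg by (simp add: zero_le_mult_iff)
  next
    case True
    \<comment> \<open>The form at \<open>x + t y\<close> is affine in \<open>t\<close>, hence constant because it is bounded below.\<close>
    have "b = 0"
    proof (rule ccontr)
      assume "b \<noteq> 0"
      \<comment> \<open>The parameter is the one at which the affine function takes the value \<open>-1\<close>.\<close>
      then show False using form[of 1 "- (a + 1) / (2 * b)"] True by (simp add: field_simps)
    qed
    then show ?thesis using True by simp
  qed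
  then show ?thesis by (simp add: a_def b_def c_def)
qed

text \<open>Cauchy--Schwarz for the form of \<open>M\<close> at \<open>M x\<close> and \<open>x\<close> gives
  \<open>\<parallel>M x\<parallel>\<^sup>4 \<le> (M x \<bullet> M (M x)) (x \<bullet> M x) \<le> c\<^sup>2 \<parallel>M x\<parallel>\<^sup>2 \<parallel>x\<parallel>\<^sup>2\<close>.\<close>

lemma psd_spectral_norm_le:
  fixes M :: "real^'n^'n"
  assumes "symmetric_matrix M" "coercive 0 M" and le: "\<And>x. x \<bullet> (M *v x) \<le> c * (x \<bullet> x)"
  shows "spectral_norm M \<le> c"
proof (rule spectral_norm_leI)
  fix x
  define u where "u = M *v x"
  \<comment> \<open>A nonzero vector forces \<open>c \<ge> 0\<close>.\<close>
  have "0 \<le> c * (axis undefined 1 \<bullet> (axis undefined 1 :: real^'n))"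
    using le[of "axis undefined 1"] assms(2) unfolding coercive_def
    by (metis mult_zero_left order_trans)
  then have c: "0 \<le> c" by (simp add: inner_axis_axis)
  have "(u \<bullet> u)\<^sup>2 \<le> (u \<bullet> (M *v u)) * (x \<bullet> (M *v x))"
    using psd_Cauchy_Schwarz[OF assms(1,2), of u x] by (simp add: u_def)
  also have "\<dots> \<le> (c * (u \<bullet> u)) * (c * (x \<bullet> x))"
    using assms(2) c by (intro mult_mono le) (auto simp: coercive_def)
  finally have "(u \<bullet> u) * (u \<bullet> u) \<le> (c\<^sup>2 * (x \<bullet> x)) * (u \<bullet> u)"
    by (simp add: power2_eq_square ac_simps)
  then have "u \<bullet> u \<le> c\<^sup>2 * (x \<bullet> x)"
    using c by (cases "u \<bullet> u = 0") (auto simp: mult_le_cancel_right not_less less_le)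
  then have "(norm u)\<^sup>2 \<le> (c * norm x)\<^sup>2"
    by (simp add: power2_norm_eq_inner power_mult_distrib)
  then show "norm (M *v x) \<le> c * norm x"
    unfolding u_def[symmetric] by (rule power2_le_imp_le) (simp add: c)
qed

lemma matrix_inv_inverse:
  fixes M :: "real^'n^'n"
  assumes "invertible M"
  shows "M ** matrix_inv M = mat 1" "matrix_inv M ** M = mat 1"
  using assms someI_ex[of "\<lambda>B. M ** B = mat 1 \<and> B ** M = mat 1"]
  by (auto simp: invertible_def matrix_inv_def)

lemma matrix_inv_eqI:
  fixes M :: "real^'n^'n"
  assumes "M ** N = mat 1"
  shows "invertible M" "matrix_inv M = N"
proof -
  show inv: "invertible M" using assms invertible_right_inverse by blast
  have "matrix_inv M = matrix_inv M ** (M ** N)" by (simp add: assms)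
  also have "\<dots> = N" by (simp add: matrix_mul_assoc matrix_inv_inverse[OF inv])
  finally show "matrix_inv M = N" .
qed

lemma coercive_inverse:
  fixes M :: "real^'n^'n"
  assumes "coercive c M" "0 < c"
  shows "invertible M" "spectral_norm (matrix_inv M) \<le> 1 / c"
proof -
  have low: "c * norm x \<le> norm (M *v x)" for x
  proof (cases "x = 0")
    case False
    have "c * (norm x * norm x) \<le> x \<bullet> (M *v x)"
      using assms(1) by (simp add: coercive_def power2_norm_eq_inner[symmetric] power2_eq_square)
    also have "\<dots> \<le> norm x * norm (M *v x)" by (rule norm_cauchy_schwarz)
    finally have "norm x * (c * norm x) \<le> norm x * norm (M *v x)" by (simp add: ac_simps)
    then show ?thesis using False by simp
  qed simp
  have "x = 0" if "M *v x = 0" for x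
    using low[of x] that assms(2) by (simp add: mult_le_0_iff)
  then show inv: "invertible M"
    unfolding invertible_left_inverse by (simp add: matrix_left_invertible_ker)
  show "spectral_norm (matrix_inv M) \<le> 1 / c"
  proof (rule spectral_norm_leI)
    fix x
    have "M *v (matrix_inv M *v x) = x"
      by (simp add: matrix_vector_mul_assoc matrix_inv_inverse[OF inv])
    then show "norm (matrix_inv M *v x) \<le> 1 / c * norm x"
      using low[of "matrix_inv M *v x"] assms(2) by (simp add: field_simps)
  qed
qed

lemma invertible_spectral_norm_inverse_pos:
  fixes M :: "real^'n^'n"
  assumes "invertible M"
  shows "1 \<le> spectral_norm M * spectral_norm (matrix_inv M)" "0 < spectral_norm (matrix_inv M)"
proof -
  show 1: "1 \<le> spectral_norm M * spectral_norm (matrix_inv M)"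
    using spectral_norm_mult[of M "matrix_inv M"]
    by (simp add: matrix_inv_inverse[OF assms] spectral_norm_mat_1)
  show "0 < spectral_norm (matrix_inv M)"
    using 1 spectral_norm_nonneg[of "matrix_inv M"] by (cases "spectral_norm (matrix_inv M) = 0") auto
qed

text \<open>Cauchy--Schwarz for the form of \<open>M\<close> at \<open>x\<close> and \<open>M\<^sup>-\<^sup>1 x\<close> gives
  \<open>\<parallel>x\<parallel>\<^sup>4 \<le> (x \<bullet> M x) (M\<^sup>-\<^sup>1 x \<bullet> x)\<close>.\<close>

lemma psd_invertible_coercive:
  fixes M :: "real^'n^'n"
  assumes "symmetric_matrix M" "coercive 0 M" "invertible M"
  shows "coercive (1 / spectral_norm (matrix_inv M)) M"
  unfolding coercive_def
proof
  fix x
  let ?s = "spectral_norm (matrix_inv M)" and ?y = "matrix_inv M *v x"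
  have s: "0 < ?s" by (rule invertible_spectral_norm_inverse_pos[OF assms(3)])
  have My: "M *v ?y = x"
    by (simp add: matrix_vector_mul_assoc matrix_inv_inverse[OF assms(3)])
  have "(x \<bullet> x)\<^sup>2 \<le> (x \<bullet> (M *v x)) * (?y \<bullet> x)"
    using psd_Cauchy_Schwarz[OF assms(1,2), of x ?y] by (simp add: My)
  also have "\<dots> \<le> (x \<bullet> (M *v x)) * (?s * (x \<bullet> x))"
    using quadratic_form_le_spectral_norm[of x "matrix_inv M"] assms(2)
    by (intro mult_left_mono) (auto simp: inner_commute coercive_def)
  finally have "(x \<bullet> x) * (x \<bullet> x) \<le> ((x \<bullet> (M *v x)) * ?s) * (x \<bullet> x)"
    by (simp add: power2_eq_square ac_simps)
  then have "x \<bullet> x \<le> (x \<bullet> (M *v x)) * ?s"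
    by (cases "x = 0") (auto simp: mult_le_cancel_right not_less)
  then show "1 / ?s * (x \<bullet> x) \<le> x \<bullet> (M *v x)"
    using s by (simp add: field_simps)
qed

section \<open>The condition number\<close>

definition spectral_cond :: "real^'n^'n \<Rightarrow> real" where
  "spectral_cond M = spectral_norm M * spectral_norm (matrix_inv M)"

lemma cond_number_invertible: "invertible M \<Longrightarrow> cond_number M = ereal (spectral_cond M)"
  by (simp add: cond_number_def spectral_cond_def)

text \<open>The resolvent identity \<open>M\<^sup>-\<^sup>1 - N\<^sup>-\<^sup>1 = M\<^sup>-\<^sup>1 (N - M) N\<^sup>-\<^sup>1\<close> makes inversion Lipschitz on
  matrices with a common lower bound \<open>c\<close>.  The resulting bound on the condition number serves both
  for the perturbation and for the continuity that the minimum requires.\<close>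

lemma spectral_cond_lipschitz:
  fixes M N :: "real^'n^'n"
  assumes "coercive c M" "coercive c N" "0 < c"
  shows "\<bar>spectral_cond M - spectral_cond N\<bar>
    \<le> (1 / c + spectral_norm N / c\<^sup>2) * spectral_norm (M - N)"
proof -
  let ?M = "matrix_inv M" and ?N = "matrix_inv N"
  let ?\<delta> = "spectral_norm (M - N)"
  note M = coercive_inverse[OF assms(1,3)] and N = coercive_inverse[OF assms(2,3)]
  have c: "0 \<le> 1 / c" using assms(3) by simp
  have "?M - ?N = ?M ** (N ** ?N) - (?M ** M) ** ?N"
    by (simp add: matrix_inv_inverse M N)
  also have "\<dots> = ?M ** ((N - M) ** ?N)"
    by (simp add: matrix_eq matrix_vector_mul_assoc[symmetric] matrix_vector_mult_diff_rdistrib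
        matrix_vector_mult_diff_distrib)
  finally have eq: "?M - ?N = ?M ** ((N - M) ** ?N)" .
  have "spectral_norm (?M - ?N) \<le> spectral_norm ?M * (spectral_norm (N - M) * spectral_norm ?N)"
    unfolding eq
    by (intro order_trans[OF spectral_norm_mult] mult_left_mono spectral_norm_mult
        spectral_norm_nonneg)
  also have "\<dots> \<le> (1 / c) * (?\<delta> * (1 / c))"
    unfolding spectral_norm_minus_commute[of N M]
    using M(2) N(2) c by (intro mult_mono mult_nonneg_nonneg spectral_norm_nonneg) auto
  finally have inv: "\<bar>spectral_norm ?M - spectral_norm ?N\<bar> \<le> ?\<delta> / c\<^sup>2"
    using spectral_norm_diff[of ?M ?N] by (simp add: power2_eq_square)
  have "\<bar>spectral_cond M - spectral_cond N\<bar>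
    = \<bar>(spectral_norm M - spectral_norm N) * spectral_norm ?M
        + spectral_norm N * (spectral_norm ?M - spectral_norm ?N)\<bar>"
    by (simp add: spectral_cond_def algebra_simps)
  also have "\<dots> \<le> \<bar>spectral_norm M - spectral_norm N\<bar> * spectral_norm ?M
        + spectral_norm N * \<bar>spectral_norm ?M - spectral_norm ?N\<bar>"
    by (rule order_trans[OF abs_triangle_ineq]) (simp add: abs_mult spectral_norm_nonneg)
  also have "\<dots> \<le> ?\<delta> * (1 / c) + spectral_norm N * (?\<delta> / c\<^sup>2)"
    by (intro add_mono mult_mono mult_left_mono inv M(2) spectral_norm_diff
        spectral_norm_nonneg order_refl)
  finally show ?thesis by (simp add: algebra_simps)
qed

text \<open>If \<open>M = L L\<^sup>T\<close> and \<open>X = L\<^sup>-\<^sup>T Q\<close> then \<open>X X\<^sup>T = M\<^sup>-\<^sup>1\<close> and \<open>X\<^sup>-\<^sup>T X\<^sup>-\<^sup>1 = M\<close>, so that the squares of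
  the singular values of \<open>X\<close> are the reciprocals of the eigenvalues of \<open>M\<close>.\<close>

lemma cond_number_cholesky:
  fixes L Q :: "real^'n^'n"
  assumes "invertible M" "M = L ** transpose L" "orthogonal_matrix Q"
  shows "cond_number (matrix_inv (transpose L) ** Q) \<le> ereal (sqrt (spectral_cond M))"
proof -
  let ?K = "matrix_inv (transpose L)"
  let ?X = "?K ** Q" and ?Y = "transpose Q ** transpose L"
  have Q: "Q ** transpose Q = mat 1" "transpose Q ** Q = mat 1"
    using assms(3) by (auto simp: orthogonal_matrix_def)
  have "det L \<noteq> 0"
    using assms(1,2) by (auto simp: invertible_det_nz det_mul)
  then have "invertible (transpose L)" by (simp add: invertible_det_nz)
  note K = matrix_inv_inverse[OF this]
  have K': "L ** transpose ?K = mat 1"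
    using arg_cong[OF K(2), of transpose] by (simp add: matrix_transpose_mul)
  have "?X ** ?Y = ?K ** (Q ** transpose Q) ** transpose L" by (simp only: matrix_mul_assoc)
  also have "\<dots> = mat 1" by (simp add: Q K)
  finally have X: "invertible ?X" "matrix_inv ?X = ?Y" by (rule matrix_inv_eqI)+
  have XX: "transpose (transpose ?X) ** transpose ?X = ?K ** (Q ** transpose Q) ** transpose ?K"
    by (simp add: matrix_transpose_mul matrix_mul_assoc)
  have "M ** (?K ** transpose ?K) = L ** (transpose L ** ?K) ** transpose ?K"
    by (simp add: assms(2) matrix_mul_assoc)
  also have "\<dots> = mat 1" by (simp add: K K')
  finally have Minv: "matrix_inv M = ?K ** transpose ?K" by (rule matrix_inv_eqI)
  have YY: "transpose ?Y ** ?Y = L ** (Q ** transpose Q) ** transpose L"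
    by (simp add: matrix_transpose_mul matrix_mul_assoc)
  have "(spectral_norm ?X)\<^sup>2 \<le> (spectral_norm (transpose ?X))\<^sup>2"
    by (intro power_mono spectral_norm_le_transpose spectral_norm_nonneg)
  also have "\<dots> \<le> spectral_norm (matrix_inv M)"
    using spectral_norm_sq_le_gram[of "transpose ?X"] unfolding XX by (simp add: Q Minv)
  finally have 1: "(spectral_norm ?X)\<^sup>2 \<le> spectral_norm (matrix_inv M)" .
  have 2: "(spectral_norm ?Y)\<^sup>2 \<le> spectral_norm M"
    using spectral_norm_sq_le_gram[of ?Y] unfolding YY by (simp add: Q assms(2))
  have "(spectral_cond ?X)\<^sup>2 \<le> spectral_cond M"
    unfolding spectral_cond_def X(2) power_mult_distrib
    using mult_mono[OF 1 2 spectral_norm_nonneg zero_le_power2] by (simp add: mult.commute)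
  then have "spectral_cond ?X \<le> sqrt (spectral_cond M)"
    by (rule real_le_rsqrt)
  then show ?thesis by (simp add: cond_number_invertible[OF X(1)])
qed

section \<open>Linear combinations of positive semidefinite matrices\<close>

lemma lincomb_mult_vector: "lincomb A \<nu> *v x = (\<Sum>k\<in>UNIV. (\<nu> $ k) *\<^sub>R (A k *v x))"
proof -
  have "(\<Sum>k\<in>S. (\<nu> $ k) *\<^sub>R A k) *v x = (\<Sum>k\<in>S. (\<nu> $ k) *\<^sub>R (A k *v x))" if "finite S" for S
    using that
    by induction (simp_all add: matrix_vector_mult_add_rdistrib scaleR_matrix_vector_assoc)
  then show ?thesis by (simp add: lincomb_def)
qed

lemma lincomb_quadratic_form:
  "x \<bullet> (lincomb A \<nu> *v x) = (\<Sum>k\<in>UNIV. \<nu> $ k * (x \<bullet> (A k *v x)))"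
  by (simp add: lincomb_mult_vector inner_sum_right)

lemma symmetric_lincomb:
  assumes "\<And>k. symmetric_matrix (A k)"
  shows "symmetric_matrix (lincomb A \<nu>)"
proof -
  have "A k $ i $ j = A k $ j $ i" for k i j
  proof -
    have "A k $ i $ j = transpose (A k) $ i $ j"
      using assms[of k] by (simp only: symmetric_matrix_def)
    then show ?thesis by (simp only: transpose_def vec_lambda_beta)
  qed
  then have "lincomb A \<nu> $ j $ i = lincomb A \<nu> $ i $ j" for i j
    by (simp only: lincomb_def sum_component vector_scaleR_component)
  then show ?thesis
    by (simp only: symmetric_matrix_def transpose_def vec_eq_iff vec_lambda_beta) simp
qed

lemma lincomb_perturbed: "lincomb (perturbed A E \<epsilon>) \<nu> = lincomb A \<nu> + \<epsilon> *\<^sub>R lincomb E \<nu>"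
  by (simp add: lincomb_def perturbed_def scaleR_right_distrib sum.distrib
      scaleR_sum_right mult.commute)

lemma lincomb_diff: "lincomb A \<nu> - lincomb A \<nu>' = lincomb A (\<nu> - \<nu>')"
  by (simp add: lincomb_def scaleR_diff_left sum_subtractf)

lemma spectral_norm_lincomb:
  assumes "\<And>k. spectral_norm (A k) = 1"
  shows "spectral_norm (lincomb A \<nu>) \<le> (\<Sum>k\<in>UNIV. \<bar>\<nu> $ k\<bar>)"
proof (rule spectral_norm_leI)
  fix x
  have "norm (lincomb A \<nu> *v x) \<le> (\<Sum>k\<in>UNIV. norm ((\<nu> $ k) *\<^sub>R (A k *v x)))"
    unfolding lincomb_mult_vector by (rule norm_sum)
  also have "\<dots> \<le> (\<Sum>k\<in>UNIV. \<bar>\<nu> $ k\<bar> * norm x)"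
    using norm_mult_le_spectral_norm[of "A _" x] assms
    by (intro sum_mono) (simp add: mult_left_mono)
  finally show "norm (lincomb A \<nu> *v x) \<le> (\<Sum>k\<in>UNIV. \<bar>\<nu> $ k\<bar>) * norm x"
    by (simp add: sum_distrib_right)
qed

lemma barycenter_pos: "0 < barycenter $ k"
  by (simp add: barycenter_def)

lemma barycenter_in_simplex: "barycenter \<in> prob_simplex"
  by (simp add: barycenter_def prob_simplex_def)

text \<open>Each \<open>A k\<close> is the limit, as \<open>\<delta>\<close> tends to 0, of the positive definite matrices whose
  coefficients are \<open>1 + \<delta>\<close> at \<open>k\<close> and \<open>\<delta>\<close> elsewhere.\<close>

lemma positive_definite_family_psd:
  fixes A :: "'d::finite \<Rightarrow> real^'n^'n"
  assumes "positive_definite_family A"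
  shows "coercive 0 (A k)"
  unfolding coercive_def
proof
  fix x
  define S where "S = (\<Sum>j\<in>UNIV. x \<bullet> (A j *v x))"
  have "0 \<le> x \<bullet> (A k *v x) + \<delta> * S" if "0 < \<delta>" for \<delta>
  proof (cases "x = 0")
    case False
    define \<mu> :: "real^'d" where "\<mu> = (\<chi> j. (if j = k then 1 else 0) + \<delta>)"
    have "positive_definite (lincomb A \<mu>)"
      using assms that by (simp add: positive_definite_family_def \<mu>_def add_pos_pos)
    then have "0 < x \<bullet> (lincomb A \<mu> *v x)"
      using False by (simp add: positive_definite_def)
    also have "\<dots> = x \<bullet> (A k *v x) + \<delta> * S"
      by (simp add: lincomb_quadratic_form \<mu>_def S_def distrib_right sum.distrib
          sum_distrib_left if_distrib[of "\<lambda>r. r * _"] cong: if_cong)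
    finally show ?thesis by simp
  qed (simp add: S_def)
  then have "\<forall>\<^sub>F \<delta> in at_right 0. 0 \<le> x \<bullet> (A k *v x) + \<delta> * S"
    by (auto simp: eventually_at_filter)
  moreover have "((\<lambda>\<delta>. x \<bullet> (A k *v x) + \<delta> * S) \<longlongrightarrow> x \<bullet> (A k *v x) + 0 * S) (at_right 0)"
    by (intro tendsto_intros)
  ultimately have "0 \<le> x \<bullet> (A k *v x) + 0 * S"
    by (intro tendsto_lowerbound[of _ _ "at_right 0"]) auto
  then show "0 * (x \<bullet> x) \<le> x \<bullet> (A k *v x)" by simp
qed

text \<open>The hypotheses on \<open>A\<close> in the form that the estimates over the simplex use.\<close>

locale normalized_psd_family =
  fixes A :: "'d::finite \<Rightarrow> real^'n^'n"
  assumes symmetric: "symmetric_matrix (A k)"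
    and psd: "coercive 0 (A k)"
    and unit: "spectral_norm (A k) = 1"
    and invertible_barycenter: "invertible (lincomb A barycenter)"
begin

lemma form_nonneg: "0 \<le> x \<bullet> (A k *v x)"
  using psd by (simp add: coercive_def)

lemma simplex_psd: "\<nu> \<in> prob_simplex \<Longrightarrow> coercive 0 (lincomb A \<nu>)"
  by (auto simp: coercive_def lincomb_quadratic_form prob_simplex_def
      intro!: sum_nonneg mult_nonneg_nonneg form_nonneg)

lemma simplex_norm_le: "\<nu> \<in> prob_simplex \<Longrightarrow> spectral_norm (lincomb A \<nu>) \<le> 1"
  using spectral_norm_lincomb[of A \<nu>, OF unit] by (simp add: prob_simplex_def)

text \<open>Some weight is at least \<open>1/d\<close>, and a sum of positive semidefinite matrices is at least as
  large as each summand.\<close>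

lemma simplex_norm_ge:
  assumes "\<nu> \<in> prob_simplex"
  shows "1 / real CARD('d) \<le> spectral_norm (lincomb A \<nu>)"
proof -
  have \<nu>: "0 \<le> \<nu> $ k" "(\<Sum>k\<in>UNIV. \<nu> $ k) = 1" for k
    using assms by (auto simp: prob_simplex_def)
  have le: "\<nu> $ k \<le> spectral_norm (lincomb A \<nu>)" for k
  proof -
    have "x \<bullet> (((\<nu> $ k) *\<^sub>R A k) *v x) \<le> spectral_norm (lincomb A \<nu>) * (x \<bullet> x)" for x
    proof -
      have "x \<bullet> (((\<nu> $ k) *\<^sub>R A k) *v x) = \<nu> $ k * (x \<bullet> (A k *v x))"
        by (simp add: scaleR_matrix_vector_assoc[symmetric])
      also have "\<dots> \<le> x \<bullet> (lincomb A \<nu> *v x)"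
        unfolding lincomb_quadratic_form
        by (rule member_le_sum[of k UNIV "\<lambda>k. \<nu> $ k * (x \<bullet> (A k *v x))"])
          (auto intro: mult_nonneg_nonneg \<nu> form_nonneg)
      also have "\<dots> \<le> spectral_norm (lincomb A \<nu>) * (x \<bullet> x)"
        using quadratic_form_le_spectral_norm[of x "lincomb A \<nu>"] by linarith
      finally show ?thesis .
    qed
    then have "spectral_norm ((\<nu> $ k) *\<^sub>R A k) \<le> spectral_norm (lincomb A \<nu>)"
      using symmetric[of k] \<nu> form_nonneg
      by (intro psd_spectral_norm_le)
        (auto simp: symmetric_matrix_def transpose_scalar coercive_def
          scaleR_matrix_vector_assoc[symmetric])
    then show ?thesis by (simp add: spectral_norm_scaleR unit \<nu>)
  qed
  have "1 \<le> (\<Sum>k\<in>(UNIV :: 'd set). spectral_norm (lincomb A \<nu>))"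
    unfolding \<nu>(2)[symmetric] by (intro sum_mono le)
  then show ?thesis by (simp add: field_simps)
qed

text \<open>All weights of \<open>\<nu>\<close> are at most 1, so \<open>A(\<nu>)\<close> is dominated by the sum of the family, which is
  \<open>d\<close> times its value at the barycenter. One factor \<open>d\<close> thus comes from the inverse, the other from
  the lower bound \<open>1/d\<close> for the norm.\<close>

lemma simplex_cond_barycenter:
  assumes \<nu>: "\<nu> \<in> prob_simplex" and inv: "invertible (lincomb A \<nu>)"
  shows "spectral_cond (lincomb A barycenter) \<le> (real CARD('d))\<^sup>2 * spectral_cond (lincomb A \<nu>)"
proof -
  let ?d = "real CARD('d)" and ?s = "spectral_norm (matrix_inv (lincomb A \<nu>))"
  have s: "0 < ?s" by (rule invertible_spectral_norm_inverse_pos[OF inv])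
  have le1: "\<nu> $ k \<le> 1" for k
    using \<nu> member_le_sum[of k UNIV "\<lambda>k. \<nu> $ k"] by (auto simp: prob_simplex_def)
  have "coercive (1 / (?d * ?s)) (lincomb A barycenter)"
    unfolding coercive_def
  proof
    fix x
    have "1 / ?s * (x \<bullet> x) \<le> x \<bullet> (lincomb A \<nu> *v x)"
      using psd_invertible_coercive[OF symmetric_lincomb[OF symmetric] simplex_psd[OF \<nu>] inv]
      by (simp add: coercive_def)
    also have "\<dots> \<le> (\<Sum>k\<in>UNIV. x \<bullet> (A k *v x))"
      unfolding lincomb_quadratic_form
      by (intro sum_mono mult_left_le_one_le form_nonneg le1)
        (use \<nu> in \<open>simp add: prob_simplex_def\<close>)
    also have "\<dots> = ?d * (x \<bullet> (lincomb A barycenter *v x))"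
      by (simp add: lincomb_quadratic_form barycenter_def sum_divide_distrib[symmetric])
    finally show "1 / (?d * ?s) * (x \<bullet> x) \<le> x \<bullet> (lincomb A barycenter *v x)"
      using s by (simp add: field_simps)
  qed
  then have "spectral_norm (matrix_inv (lincomb A barycenter)) \<le> ?d * ?s"
    using coercive_inverse(2) s by fastforce
  then have "spectral_cond (lincomb A barycenter) \<le> 1 * (?d * ?s)"
    unfolding spectral_cond_def
    by (intro mult_mono simplex_norm_le barycenter_in_simplex spectral_norm_nonneg) simp_all
  also have "\<dots> = ?d\<^sup>2 * (1 / ?d * ?s)" by (simp add: power2_eq_square)
  also have "\<dots> \<le> ?d\<^sup>2 * spectral_cond (lincomb A \<nu>)"
    unfolding spectral_cond_def
    by (intro mult_left_mono mult_right_mono simplex_norm_ge \<nu> spectral_norm_nonneg) simp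
  finally show ?thesis .
qed

lemma compact_coercive_simplex: "compact {\<nu> \<in> prob_simplex. coercive c (lincomb A \<nu>)}"
proof -
  let ?K = "{\<nu> \<in> prob_simplex. coercive c (lincomb A \<nu>)}"
  have "norm \<nu> \<le> 1" if "\<nu> \<in> prob_simplex" for \<nu> :: "real^'d"
    using norm_le_l1_cart[of \<nu>] that by (simp add: prob_simplex_def)
  then have "bounded ?K" by (auto simp: bounded_iff)
  moreover have "?K = {\<nu>. (\<Sum>k\<in>UNIV. \<nu> $ k) = 1 \<and> (\<forall>k. 0 \<le> \<nu> $ k)
      \<and> (\<forall>x. c * (x \<bullet> x) \<le> (\<Sum>k\<in>UNIV. \<nu> $ k * (x \<bullet> (A k *v x))))}"
    by (auto simp: coercive_def prob_simplex_def lincomb_quadratic_form)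
  then have "closed ?K"
    by (simp only:)
      (intro closed_Collect_conj closed_Collect_all closed_Collect_eq closed_Collect_le
        continuous_intros)
  ultimately show ?thesis by (simp add: compact_eq_bounded_closed)
qed

lemma continuous_spectral_cond:
  assumes "0 < c"
  shows "continuous_on {\<nu> \<in> prob_simplex. coercive c (lincomb A \<nu>)}
    (\<lambda>\<nu>. spectral_cond (lincomb A \<nu>))"
proof (rule lipschitz_on_continuous_on, rule lipschitz_onI)
  fix \<nu> \<nu>' assume K: "\<nu> \<in> {\<nu> \<in> prob_simplex. coercive c (lincomb A \<nu>)}"
    "\<nu>' \<in> {\<nu> \<in> prob_simplex. coercive c (lincomb A \<nu>)}"
  have "\<bar>spectral_cond (lincomb A \<nu>) - spectral_cond (lincomb A \<nu>')\<bar>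
    \<le> (1 / c + spectral_norm (lincomb A \<nu>') / c\<^sup>2) * spectral_norm (lincomb A \<nu> - lincomb A \<nu>')"
    using K assms by (intro spectral_cond_lipschitz) auto
  also have "\<dots> \<le> (1 / c + 1 / c\<^sup>2) * (real CARD('d) * norm (\<nu> - \<nu>'))"
  proof (intro mult_mono add_left_mono divide_right_mono)
    show "spectral_norm (lincomb A \<nu>') \<le> 1" using K simplex_norm_le by simp
    have "(\<Sum>k\<in>UNIV. \<bar>(\<nu> - \<nu>') $ k\<bar>) \<le> real CARD('d) * norm (\<nu> - \<nu>')"
      by (intro sum_bounded_above component_le_norm_cart)
    then show "spectral_norm (lincomb A \<nu> - lincomb A \<nu>') \<le> real CARD('d) * norm (\<nu> - \<nu>')"
      using spectral_norm_lincomb[of A "\<nu> - \<nu>'", OF unit] by (simp add: lincomb_diff)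
  qed (use assms in \<open>auto intro: spectral_norm_nonneg\<close>)
  finally show "dist (spectral_cond (lincomb A \<nu>)) (spectral_cond (lincomb A \<nu>'))
    \<le> (1 / c + 1 / c\<^sup>2) * real CARD('d) * dist \<nu> \<nu>'"
    by (simp add: dist_norm mult.assoc)
qed (use assms in simp)

text \<open>The condition number is infinite at singular matrices, so compactness of the simplex alone
  does not give a minimum.  But a point \<open>\<nu>\<close> that does no worse than the barycenter, where the
  condition number is \<open>\<kappa>\<close>, satisfies \<open>\<parallel>A(\<nu>)\<^sup>-\<^sup>1\<parallel> \<le> d \<kappa>\<close> because \<open>\<parallel>A(\<nu>)\<parallel> \<ge> 1/d\<close>.  Such points lie in a
  compact set on which the condition number is continuous.\<close>

lemma min_cond_attained:
  obtains \<nu> where "\<nu> \<in> prob_simplex" "invertible (lincomb A \<nu>)"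
    "min_cond A = ereal (spectral_cond (lincomb A \<nu>))"
proof -
  let ?d = "real CARD('d)"
  define \<kappa> where "\<kappa> = spectral_cond (lincomb A barycenter)"
  define c where "c = 1 / (?d * \<kappa>)"
  define K where "K = {\<nu> \<in> prob_simplex. coercive c (lincomb A \<nu>)}"
  have "1 \<le> \<kappa>"
    unfolding \<kappa>_def spectral_cond_def
    by (rule invertible_spectral_norm_inverse_pos[OF invertible_barycenter])
  then have c: "0 < c" by (simp add: c_def)
  have in_K: "\<nu> \<in> K" if \<nu>: "\<nu> \<in> prob_simplex" and inv: "invertible (lincomb A \<nu>)"
    and le: "spectral_cond (lincomb A \<nu>) \<le> \<kappa>" for \<nu>
  proof -
    let ?s = "spectral_norm (matrix_inv (lincomb A \<nu>))"
    have s: "0 < ?s" by (rule invertible_spectral_norm_inverse_pos[OF inv])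
    have "1 / ?d * ?s \<le> spectral_cond (lincomb A \<nu>)"
      unfolding spectral_cond_def
      by (intro mult_right_mono simplex_norm_ge \<nu> spectral_norm_nonneg)
    then have "?s \<le> ?d * spectral_cond (lincomb A \<nu>)" by (simp add: field_simps)
    also have "\<dots> \<le> ?d * \<kappa>" using le by (simp add: mult_left_mono)
    finally have "?s \<le> ?d * \<kappa>" .
    then have cs: "c \<le> 1 / ?s" unfolding c_def using s by (intro divide_left_mono) auto
    have "coercive (1 / ?s) (lincomb A \<nu>)"
      by (rule psd_invertible_coercive[OF symmetric_lincomb[OF symmetric] simplex_psd[OF \<nu>] inv])
    then have "coercive c (lincomb A \<nu>)"
      unfolding coercive_def using cs by (meson inner_ge_zero mult_right_mono order_trans)
    with \<nu> show ?thesis by (simp add: K_def)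
  qed
  have bK: "barycenter \<in> K"
    by (rule in_K) (simp_all add: barycenter_in_simplex invertible_barycenter \<kappa>_def)
  obtain \<nu> where \<nu>: "\<nu> \<in> K"
    and min: "\<And>\<nu>'. \<nu>' \<in> K \<Longrightarrow> spectral_cond (lincomb A \<nu>) \<le> spectral_cond (lincomb A \<nu>')"
    using continuous_attains_inf[of K "\<lambda>\<nu>. spectral_cond (lincomb A \<nu>)"] bK
      compact_coercive_simplex continuous_spectral_cond[OF c]
    unfolding K_def by blast
  have simplex: "\<nu> \<in> prob_simplex" and inv: "invertible (lincomb A \<nu>)"
    using \<nu> c coercive_inverse(1) by (auto simp: K_def)
  have glob: "ereal (spectral_cond (lincomb A \<nu>)) \<le> cond_number (lincomb A \<nu>')"
    if "\<nu>' \<in> prob_simplex" for \<nu>'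
  proof (cases "invertible (lincomb A \<nu>')")
    case True
    have "spectral_cond (lincomb A \<nu>) \<le> spectral_cond (lincomb A \<nu>')"
    proof (cases "spectral_cond (lincomb A \<nu>') \<le> \<kappa>")
      case False
      then show ?thesis using min[OF bK] by (simp add: \<kappa>_def)
    qed (use min in_K that True in blast)
    then show ?thesis by (simp add: cond_number_invertible True)
  qed (simp add: cond_number_def)
  have "min_cond A = ereal (spectral_cond (lincomb A \<nu>))"
    unfolding min_cond_def
    using glob by (intro Least_equality bexI[OF _ simplex]) (auto simp: cond_number_invertible[OF inv])
  then show thesis by (rule that[OF simplex inv])
qed

lemma sqrt_cond_barycenter:
  "sqrt (spectral_cond (lincomb A barycenter))
    \<le> real CARD('d) * sqrt (real_of_ereal (min_cond A))"
proof -
  obtain \<nu> where \<nu>: "\<nu> \<in> prob_simplex" "invertible (lincomb A \<nu>)"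
    "min_cond A = ereal (spectral_cond (lincomb A \<nu>))"
    by (rule min_cond_attained)
  have "sqrt (spectral_cond (lincomb A barycenter))
      \<le> sqrt ((real CARD('d))\<^sup>2 * spectral_cond (lincomb A \<nu>))"
    by (intro real_sqrt_le_mono simplex_cond_barycenter \<nu>)
  then show ?thesis by (simp add: real_sqrt_mult \<nu>(3))
qed

end

section \<open>The perturbed family\<close>

lemma coercive_perturb:
  fixes M F :: "real^'n^'n"
  assumes "coercive (2 * c) M" "\<bar>\<epsilon>\<bar> * spectral_norm F \<le> c"
  shows "coercive c (M + \<epsilon> *\<^sub>R F)"
  unfolding coercive_def
proof
  fix x
  have "\<bar>x \<bullet> (\<epsilon> *\<^sub>R F *v x)\<bar> \<le> spectral_norm (\<epsilon> *\<^sub>R F) * (x \<bullet> x)"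
    by (rule quadratic_form_le_spectral_norm)
  also have "\<dots> \<le> c * (x \<bullet> x)"
    using assms(2) by (intro mult_right_mono) (simp_all add: spectral_norm_scaleR)
  finally have 1: "\<bar>x \<bullet> (\<epsilon> *\<^sub>R F *v x)\<bar> \<le> c * (x \<bullet> x)" .
  have 2: "2 * c * (x \<bullet> x) \<le> x \<bullet> (M *v x)"
    using assms(1) by (simp add: coercive_def)
  have "x \<bullet> ((M + \<epsilon> *\<^sub>R F) *v x) = x \<bullet> (M *v x) + x \<bullet> (\<epsilon> *\<^sub>R F *v x)"
    by (simp add: matrix_vector_mult_add_rdistrib inner_add_right)
  with 1 2 show "c * (x \<bullet> x) \<le> x \<bullet> ((M + \<epsilon> *\<^sub>R F) *v x)" by argo
qed

theorem lemma16:
  fixes A E :: "'d::finite \<Rightarrow> real^'n::{finite,linorder}^'n::{finite,linorder}"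
  assumes "SDC A"
    and "positive_definite_family A"
    and "\<And>k. spectral_norm (A k) = 1"
    and "\<And>k. symmetric_matrix (E k)"
  shows "\<exists>g :: real \<Rightarrow> real. g \<in> O[at_right 0](\<lambda>\<epsilon>. \<epsilon>) \<and>
    (\<forall>\<^sub>F \<epsilon> in at_right 0.
       positive_definite (lincomb (perturbed A E \<epsilon>) barycenter) \<and>
       (\<forall>(\<mu> :: real^'d) L Q.
          lower_triangular L \<longrightarrow>
          lincomb (perturbed A E \<epsilon>) barycenter = L ** transpose L \<longrightarrow>
          orthogonal_matrix Q \<longrightarrow>
          diagonal_matrix (transpose Q ** matrix_inv L ** lincomb (perturbed A E \<epsilon>) \<mu>
             ** matrix_inv (transpose L) ** Q) \<longrightarrow>
          cond_number (matrix_inv (transpose L) ** Q)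
            \<le> ereal (real CARD('d) * sqrt (real_of_ereal (min_cond A)) + g \<epsilon>)))"
proof -
  let ?M = "lincomb A barycenter" and ?F = "lincomb E barycenter"
  let ?P = "\<lambda>\<epsilon>. lincomb (perturbed A E \<epsilon>) barycenter"
  have sym: "symmetric_matrix (A k)" for k
    using assms(2) by (simp add: positive_definite_family_def)
  have "positive_definite ?M"
    using assms(2) barycenter_pos by (auto simp: positive_definite_family_def)
  then have "x = 0" if "?M *v x = 0" for x
    using that by (auto simp: positive_definite_def)
  then have inv: "invertible ?M"
    unfolding invertible_left_inverse by (simp add: matrix_left_invertible_ker)
  interpret normalized_psd_family A
    using sym positive_definite_family_psd[OF assms(2)] assms(3) inv by unfold_locales
  \<comment> \<open>Half the smallest eigenvalue of \<open>A(\<theta>)\<close>: the perturbation may consume the other half.\<close>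
  define c where "c = 1 / spectral_norm (matrix_inv ?M) / 2"
  have c: "0 < c"
    using invertible_spectral_norm_inverse_pos[OF inv] by (simp add: c_def)
  have M2: "coercive (2 * c) ?M"
    using psd_invertible_coercive[OF symmetric_lincomb[OF sym]
        simplex_psd[OF barycenter_in_simplex] inv]
    by (simp add: c_def)
  have M1: "coercive c ?M"
    using coercive_perturb[OF M2, of 0 0] c by simp
  define C where "C = (1 / c + spectral_norm ?M / c\<^sup>2) * spectral_norm ?F"
  have C: "0 \<le> C"
    using c by (simp add: C_def spectral_norm_nonneg)
  have bound: "positive_definite (?P \<epsilon>)
      \<and> (\<forall>L Q. ?P \<epsilon> = L ** transpose L \<longrightarrow> orthogonal_matrix Q \<longrightarrow>
          cond_number (matrix_inv (transpose L) ** Q)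
            \<le> ereal (real CARD('d) * sqrt (real_of_ereal (min_cond A)) + C * \<epsilon>))"
    if \<epsilon>: "0 < \<epsilon>" "\<epsilon> * spectral_norm ?F \<le> c" for \<epsilon>
  proof -
    have P: "coercive c (?P \<epsilon>)"
      unfolding lincomb_perturbed using \<epsilon> by (intro coercive_perturb M2) simp
    note invP = coercive_inverse(1)[OF P c]
    have "0 < x \<bullet> (?P \<epsilon> *v x)" if "x \<noteq> 0" for x
    proof -
      have "0 < c * (x \<bullet> x)" using that c by simp
      also have "\<dots> \<le> x \<bullet> (?P \<epsilon> *v x)" using P by (simp add: coercive_def)
      finally show ?thesis .
    qed
    moreover have "symmetric_matrix (?P \<epsilon>)"
      using sym assms(4) unfolding perturbed_def
      by (intro symmetric_lincomb)
        (simp add: symmetric_matrix_def vec_eq_iff transpose_def)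
    ultimately have pd: "positive_definite (?P \<epsilon>)" by (simp add: positive_definite_def)
    let ?\<kappa> = "spectral_cond ?M"
    have \<kappa>: "1 \<le> ?\<kappa>"
      unfolding spectral_cond_def by (rule invertible_spectral_norm_inverse_pos[OF inv])
    have "spectral_cond (?P \<epsilon>) \<le> ?\<kappa> + C * \<epsilon>"
      using spectral_cond_lipschitz[OF P M1 c] \<epsilon>(1)
      by (simp add: lincomb_perturbed spectral_norm_scaleR C_def ac_simps)
    \<comment> \<open>The mixed term of the square alone is at least \<open>C \<epsilon>\<close> because \<open>\<kappa> \<ge> 1\<close>.\<close>
    also have "\<dots> \<le> (sqrt ?\<kappa> + C * \<epsilon>)\<^sup>2"
    proof -
      have "C * \<epsilon> * 1 \<le> C * \<epsilon> * sqrt ?\<kappa>"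
        using \<kappa> C \<epsilon>(1) by (intro mult_left_mono) auto
      moreover have "0 \<le> C * \<epsilon> * 1" using C \<epsilon>(1) by simp
      ultimately have "C * \<epsilon> \<le> 2 * sqrt ?\<kappa> * (C * \<epsilon>)"
        by (simp add: mult.commute)
      moreover have "(sqrt ?\<kappa> + C * \<epsilon>)\<^sup>2 = ?\<kappa> + 2 * sqrt ?\<kappa> * (C * \<epsilon>) + (C * \<epsilon>)\<^sup>2"
        using \<kappa> by (simp add: power2_sum)
      ultimately show ?thesis by (smt (verit) zero_le_power2)
    qed
    finally have "sqrt (spectral_cond (?P \<epsilon>)) \<le> sqrt ?\<kappa> + C * \<epsilon>"
      using \<kappa> C \<epsilon>(1) by (intro real_le_lsqrt) auto
    also have "\<dots> \<le> real CARD('d) * sqrt (real_of_ereal (min_cond A)) + C * \<epsilon>"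
      using sqrt_cond_barycenter by simp
    finally have "ereal (sqrt (spectral_cond (?P \<epsilon>)))
        \<le> ereal (real CARD('d) * sqrt (real_of_ereal (min_cond A)) + C * \<epsilon>)"
      by simp
    with pd cond_number_cholesky[OF invP] show ?thesis by (blast intro: order_trans)
  qed
  \<comment> \<open>The summand 1 covers a vanishing perturbation at the barycenter.\<close>
  define e where "e = c / (spectral_norm ?F + 1)"
  have F: "0 \<le> spectral_norm ?F" by (rule spectral_norm_nonneg)
  then have e: "0 < e" using c by (simp add: e_def)
  have small: "\<epsilon> * spectral_norm ?F \<le> c" if "0 < \<epsilon>" "\<epsilon> < e" for \<epsilon>
  proof -
    have "\<epsilon> * (spectral_norm ?F + 1) < c"
      using that F by (simp add: e_def pos_less_divide_eq)
    then show ?thesis using that(1) by (simp add: distrib_left)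
  qed
  have "\<forall>\<^sub>F \<epsilon> in at_right 0. 0 < \<epsilon> \<and> \<epsilon> < e"
    using e unfolding eventually_at_right_field by blast
  then have "\<forall>\<^sub>F \<epsilon> in at_right 0. positive_definite (?P \<epsilon>)
      \<and> (\<forall>L Q. ?P \<epsilon> = L ** transpose L \<longrightarrow> orthogonal_matrix Q \<longrightarrow>
          cond_number (matrix_inv (transpose L) ** Q)
            \<le> ereal (real CARD('d) * sqrt (real_of_ereal (min_cond A)) + C * \<epsilon>))"
    by (rule eventually_mono) (rule bound, simp_all add: small)
  moreover have "(\<lambda>\<epsilon>. C * \<epsilon>) \<in> O[at_right 0](\<lambda>\<epsilon>. \<epsilon>)" by simp
  ultimately show ?thesis
    by (intro exI[of _ "\<lambda>\<epsilon>. C * \<epsilon>"] conjI) (assumption, erule eventually_mono, simp)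
qed

end
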